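(* Let $R$ and $S$ be unital $2$-torsion free rings, let $M$ be a unital $2$-torsion free $(R,S)$-bimodule which is faithful as a left $R$-module and faithful as a right $S$-module, and let $T=\mathrm{Tri}(R,M,S)$ be the associated triangular ring. Let $\varphi:T\to T$ be an additive map such that for all $X,Y\in T$, $$XY=YX=0 \implies X\varphi(Y)+\varphi(Y)X=0.$$ Then $\varphi$ is a centralizer.
   Context: All rings are associative. The triangular ring $\mathrm{Tri}(R,M,S)$ is the ring of all matrices $\begin{pmatrix} r & m\\ 0 & s\end{pmatrix}$ with $r\in R$, $m\in M$, $s\in S$, under the usual matrix operations. A ring or module is $2$-torsion free if $2x=0$ implies $x=0$. An additive map $\varphi$ on a ring $A$ is a centralizer if $\varphi(xy)=x\varphi(y)=\varphi(x)y$ for all $x,y\in A$. *)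

theory Defs
  imports "HOL-Algebra.Module"
begin

text \<open>
  The library locale \<open>module\<close> requires a commutative ring of scalars, so bimodules are
  introduced here for arbitrary unital associative rings. As for the library record \<open>module\<close>,
  the fields \<open>mult\<close> and \<open>one\<close> inherited from \<open>ring\<close> are not used; \<open>\<odot>\<close> is the left action of \<open>R\<close>
  and \<open>\<triangleleft>\<close> the right action of \<open>S\<close>.
\<close>

record ('a, 'm, 'b) bimodule = "('a, 'm) module" +
  rsmult :: "['m, 'b] \<Rightarrow> 'm" (infixl \<open>\<triangleleft>\<index>\<close> 70)

locale bimodule = R?: ring R + S?: ring S + M?: abelian_group M
  for R :: "('a, 'c) ring_scheme" and S :: "('b, 'd) ring_scheme"
    and M :: "('a, 'm, 'b, 'e) bimodule_scheme" +
  assumes l_closed: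
      "\<lbrakk>r \<in> carrier R; m \<in> carrier M\<rbrakk> \<Longrightarrow> r \<odot>\<^bsub>M\<^esub> m \<in> carrier M"
    and l_distr_scalar:
      "\<lbrakk>r \<in> carrier R; r' \<in> carrier R; m \<in> carrier M\<rbrakk> \<Longrightarrow>
        (r \<oplus>\<^bsub>R\<^esub> r') \<odot>\<^bsub>M\<^esub> m = r \<odot>\<^bsub>M\<^esub> m \<oplus>\<^bsub>M\<^esub> r' \<odot>\<^bsub>M\<^esub> m"
    and l_distr_vector:
      "\<lbrakk>r \<in> carrier R; m \<in> carrier M; n \<in> carrier M\<rbrakk> \<Longrightarrow>
        r \<odot>\<^bsub>M\<^esub> (m \<oplus>\<^bsub>M\<^esub> n) = r \<odot>\<^bsub>M\<^esub> m \<oplus>\<^bsub>M\<^esub> r \<odot>\<^bsub>M\<^esub> n"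
    and l_assoc:
      "\<lbrakk>r \<in> carrier R; r' \<in> carrier R; m \<in> carrier M\<rbrakk> \<Longrightarrow>
        (r \<otimes>\<^bsub>R\<^esub> r') \<odot>\<^bsub>M\<^esub> m = r \<odot>\<^bsub>M\<^esub> (r' \<odot>\<^bsub>M\<^esub> m)"
    and l_unit:
      "m \<in> carrier M \<Longrightarrow> \<one>\<^bsub>R\<^esub> \<odot>\<^bsub>M\<^esub> m = m"
    and r_closed:
      "\<lbrakk>m \<in> carrier M; s \<in> carrier S\<rbrakk> \<Longrightarrow> m \<triangleleft>\<^bsub>M\<^esub> s \<in> carrier M"
    and r_distr_scalar:
      "\<lbrakk>m \<in> carrier M; s \<in> carrier S; s' \<in> carrier S\<rbrakk> \<Longrightarrow>
        m \<triangleleft>\<^bsub>M\<^esub> (s \<oplus>\<^bsub>S\<^esub> s') = m \<triangleleft>\<^bsub>M\<^esub> s \<oplus>\<^bsub>M\<^esub> m \<triangleleft>\<^bsub>M\<^esub> s'"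
    and r_distr_vector:
      "\<lbrakk>m \<in> carrier M; n \<in> carrier M; s \<in> carrier S\<rbrakk> \<Longrightarrow>
        (m \<oplus>\<^bsub>M\<^esub> n) \<triangleleft>\<^bsub>M\<^esub> s = m \<triangleleft>\<^bsub>M\<^esub> s \<oplus>\<^bsub>M\<^esub> n \<triangleleft>\<^bsub>M\<^esub> s"
    and r_assoc:
      "\<lbrakk>m \<in> carrier M; s \<in> carrier S; s' \<in> carrier S\<rbrakk> \<Longrightarrow>
        m \<triangleleft>\<^bsub>M\<^esub> (s \<otimes>\<^bsub>S\<^esub> s') = (m \<triangleleft>\<^bsub>M\<^esub> s) \<triangleleft>\<^bsub>M\<^esub> s'"
    and r_unit:
      "m \<in> carrier M \<Longrightarrow> m \<triangleleft>\<^bsub>M\<^esub> \<one>\<^bsub>S\<^esub> = m"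
    and lr_assoc:
      "\<lbrakk>r \<in> carrier R; m \<in> carrier M; s \<in> carrier S\<rbrakk> \<Longrightarrow>
        (r \<odot>\<^bsub>M\<^esub> m) \<triangleleft>\<^bsub>M\<^esub> s = r \<odot>\<^bsub>M\<^esub> (m \<triangleleft>\<^bsub>M\<^esub> s)"

definition faithful_left ::
    "('a, 'c) ring_scheme \<Rightarrow> ('a, 'm, 'b, 'e) bimodule_scheme \<Rightarrow> bool" where
  "faithful_left R M \<longleftrightarrow>
    (\<forall>r\<in>carrier R. (\<forall>m\<in>carrier M. r \<odot>\<^bsub>M\<^esub> m = \<zero>\<^bsub>M\<^esub>) \<longrightarrow> r = \<zero>\<^bsub>R\<^esub>)"

definition faithful_right ::
    "('b, 'd) ring_scheme \<Rightarrow> ('a, 'm, 'b, 'e) bimodule_scheme \<Rightarrow> bool" where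
  "faithful_right S M \<longleftrightarrow>
    (\<forall>s\<in>carrier S. (\<forall>m\<in>carrier M. m \<triangleleft>\<^bsub>M\<^esub> s = \<zero>\<^bsub>M\<^esub>) \<longrightarrow> s = \<zero>\<^bsub>S\<^esub>)"

text \<open>Only the additive structure is used, so this applies to rings and to modules alike.\<close>

definition two_torsion_free :: "('a, 'c) ring_scheme \<Rightarrow> bool" where
  "two_torsion_free A \<longleftrightarrow> (\<forall>x\<in>carrier A. x \<oplus>\<^bsub>A\<^esub> x = \<zero>\<^bsub>A\<^esub> \<longrightarrow> x = \<zero>\<^bsub>A\<^esub>)"

text \<open>
  The triple \<open>(r, m, s)\<close> stands for the matrix with rows \<open>r, m\<close> and \<open>0, s\<close>; the operations are
  those of \<open>2 \<times> 2\<close> matrices.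
\<close>

definition Tri ::
    "('a, 'c) ring_scheme \<Rightarrow> ('a, 'm, 'b, 'e) bimodule_scheme \<Rightarrow> ('b, 'd) ring_scheme
      \<Rightarrow> ('a \<times> 'm \<times> 'b) ring" where
  "Tri R M S =
    \<lparr>carrier = carrier R \<times> carrier M \<times> carrier S,
     mult = (\<lambda>(r, m, s) (r', m', s').
       (r \<otimes>\<^bsub>R\<^esub> r', r \<odot>\<^bsub>M\<^esub> m' \<oplus>\<^bsub>M\<^esub> m \<triangleleft>\<^bsub>M\<^esub> s', s \<otimes>\<^bsub>S\<^esub> s')),
     one = (\<one>\<^bsub>R\<^esub>, \<zero>\<^bsub>M\<^esub>, \<one>\<^bsub>S\<^esub>),
     zero = (\<zero>\<^bsub>R\<^esub>, \<zero>\<^bsub>M\<^esub>, \<zero>\<^bsub>S\<^esub>),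
     add = (\<lambda>(r, m, s) (r', m', s'). (r \<oplus>\<^bsub>R\<^esub> r', m \<oplus>\<^bsub>M\<^esub> m', s \<oplus>\<^bsub>S\<^esub> s'))\<rparr>"

definition additive_map :: "('a, 'c) ring_scheme \<Rightarrow> ('a \<Rightarrow> 'a) \<Rightarrow> bool" where
  "additive_map A \<phi> \<longleftrightarrow> \<phi> \<in> hom (add_monoid A) (add_monoid A)"

definition centralizer :: "('a, 'c) ring_scheme \<Rightarrow> ('a \<Rightarrow> 'a) \<Rightarrow> bool" where
  "centralizer A \<phi> \<longleftrightarrow> additive_map A \<phi> \<and>
    (\<forall>x\<in>carrier A. \<forall>y\<in>carrier A.
      \<phi> (x \<otimes>\<^bsub>A\<^esub> y) = x \<otimes>\<^bsub>A\<^esub> \<phi> y \<and> x \<otimes>\<^bsub>A\<^esub> \<phi> y = \<phi> x \<otimes>\<^bsub>A\<^esub> y)"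

lemma (in bimodule) l_zero_scalar:
  assumes "m \<in> carrier M" shows "\<zero>\<^bsub>R\<^esub> \<odot>\<^bsub>M\<^esub> m = \<zero>\<^bsub>M\<^esub>"
  using l_distr_scalar[of "\<zero>\<^bsub>R\<^esub>" "\<zero>\<^bsub>R\<^esub>" m] l_closed[of "\<zero>\<^bsub>R\<^esub>" m] assms
  by (metis M.add.l_cancel_one' R.l_zero R.zero_closed)

lemma (in bimodule) l_zero_vector:
  assumes "r \<in> carrier R" shows "r \<odot>\<^bsub>M\<^esub> \<zero>\<^bsub>M\<^esub> = \<zero>\<^bsub>M\<^esub>"
  using l_distr_vector[of r "\<zero>\<^bsub>M\<^esub>" "\<zero>\<^bsub>M\<^esub>"] l_closed[of r "\<zero>\<^bsub>M\<^esub>"] assms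
  by (metis M.add.l_cancel_one' M.l_zero M.zero_closed)

lemma (in bimodule) r_zero_scalar:
  assumes "m \<in> carrier M" shows "m \<triangleleft>\<^bsub>M\<^esub> \<zero>\<^bsub>S\<^esub> = \<zero>\<^bsub>M\<^esub>"
  using r_distr_scalar[of m "\<zero>\<^bsub>S\<^esub>" "\<zero>\<^bsub>S\<^esub>"] r_closed[of m "\<zero>\<^bsub>S\<^esub>"] assms
  by (metis M.add.l_cancel_one' S.l_zero S.zero_closed)

lemma (in bimodule) r_zero_vector:
  assumes "s \<in> carrier S" shows "\<zero>\<^bsub>M\<^esub> \<triangleleft>\<^bsub>M\<^esub> s = \<zero>\<^bsub>M\<^esub>"
  using r_distr_vector[of "\<zero>\<^bsub>M\<^esub>" "\<zero>\<^bsub>M\<^esub>" s] r_closed[of "\<zero>\<^bsub>M\<^esub>" s] assms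
  by (metis M.add.l_cancel_one' M.l_zero M.zero_closed)

lemma (in bimodule) ring_Tri: "ring (Tri R M S)"
proof (intro ringI abelian_groupI monoidI)
  fix x assume "x \<in> carrier (Tri R M S)"
  then obtain r m s where x: "x = (r, m, s)"
    and "r \<in> carrier R" "m \<in> carrier M" "s \<in> carrier S"
    by (auto simp: Tri_def)
  then show "\<exists>y\<in>carrier (Tri R M S). y \<oplus>\<^bsub>Tri R M S\<^esub> x = \<zero>\<^bsub>Tri R M S\<^esub>"
    by (intro bexI[of _ "(\<ominus>\<^bsub>R\<^esub> r, \<ominus>\<^bsub>M\<^esub> m, \<ominus>\<^bsub>S\<^esub> s)"])
      (auto simp: Tri_def R.l_neg S.l_neg M.l_neg)
qed (auto simp: Tri_def l_closed r_closed R.a_ac S.a_ac M.a_ac R.m_assoc S.m_assoc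
    R.l_distr R.r_distr S.l_distr S.r_distr l_distr_scalar l_distr_vector
    r_distr_scalar r_distr_vector l_assoc r_assoc lr_assoc l_unit r_unit
    l_zero_scalar l_zero_vector r_zero_scalar r_zero_vector)

end

theory Submission
  imports Defs
begin

text \<open>
  Testing the hypothesis on annihilating pairs with entries such as \<open>(1, m, 0)\<close> and
  \<open>(0, -(m \<triangleleft> s), s)\<close> shows that \<open>\<phi>\<close> acts entrywise, \<open>\<phi> (r, m, s) = (f r, h m, g s)\<close>, with
  \<open>h (r \<odot> m) = f r \<odot> m\<close> and \<open>h (m \<triangleleft> s) = m \<triangleleft> g s\<close>. Hence \<open>h m = f 1 \<odot> m = m \<triangleleft> g 1\<close>, and
  faithfulness of \<open>M\<close> turns this into \<open>\<phi> X = Z X = X Z\<close> for the central element \<open>Z = (f 1, 0, g 1)\<close>.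
\<close>

lemma (in abelian_group) eq_if_minus_eq_zero:
  assumes "x \<oplus> \<ominus> y = \<zero>" "x \<in> carrier G" "y \<in> carrier G"
  shows "x = y"
  using minus_equality[of x "\<ominus> y"] assms by simp

lemma (in bimodule) l_minus_vector:
  assumes "r \<in> carrier R" "m \<in> carrier M"
  shows "r \<odot>\<^bsub>M\<^esub> (\<ominus>\<^bsub>M\<^esub> m) = \<ominus>\<^bsub>M\<^esub> (r \<odot>\<^bsub>M\<^esub> m)"
proof -
  have "r \<odot>\<^bsub>M\<^esub> (\<ominus>\<^bsub>M\<^esub> m) \<oplus>\<^bsub>M\<^esub> r \<odot>\<^bsub>M\<^esub> m = \<zero>\<^bsub>M\<^esub>"
    using assms l_distr_vector[of r "\<ominus>\<^bsub>M\<^esub> m" m] by (simp add: M.l_neg l_zero_vector)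
  then show ?thesis
    using assms by (simp add: M.minus_equality l_closed)
qed

lemma (in bimodule) r_minus_vector:
  assumes "m \<in> carrier M" "s \<in> carrier S"
  shows "(\<ominus>\<^bsub>M\<^esub> m) \<triangleleft>\<^bsub>M\<^esub> s = \<ominus>\<^bsub>M\<^esub> (m \<triangleleft>\<^bsub>M\<^esub> s)"
proof -
  have "(\<ominus>\<^bsub>M\<^esub> m) \<triangleleft>\<^bsub>M\<^esub> s \<oplus>\<^bsub>M\<^esub> m \<triangleleft>\<^bsub>M\<^esub> s = \<zero>\<^bsub>M\<^esub>"
    using assms r_distr_vector[of "\<ominus>\<^bsub>M\<^esub> m" m s] by (simp add: M.l_neg r_zero_vector)
  then show ?thesis
    using assms by (simp add: M.minus_equality r_closed)
qed

lemma (in bimodule) l_minus_scalar: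
  assumes "r \<in> carrier R" "m \<in> carrier M"
  shows "(\<ominus>\<^bsub>R\<^esub> r) \<odot>\<^bsub>M\<^esub> m = \<ominus>\<^bsub>M\<^esub> (r \<odot>\<^bsub>M\<^esub> m)"
proof -
  have "(\<ominus>\<^bsub>R\<^esub> r) \<odot>\<^bsub>M\<^esub> m \<oplus>\<^bsub>M\<^esub> r \<odot>\<^bsub>M\<^esub> m = \<zero>\<^bsub>M\<^esub>"
    using assms l_distr_scalar[of "\<ominus>\<^bsub>R\<^esub> r" r m] by (simp add: R.l_neg l_zero_scalar)
  then show ?thesis
    using assms by (simp add: M.minus_equality l_closed)
qed

lemma (in bimodule) r_minus_scalar:
  assumes "m \<in> carrier M" "s \<in> carrier S"
  shows "m \<triangleleft>\<^bsub>M\<^esub> (\<ominus>\<^bsub>S\<^esub> s) = \<ominus>\<^bsub>M\<^esub> (m \<triangleleft>\<^bsub>M\<^esub> s)"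
proof -
  have "m \<triangleleft>\<^bsub>M\<^esub> (\<ominus>\<^bsub>S\<^esub> s) \<oplus>\<^bsub>M\<^esub> m \<triangleleft>\<^bsub>M\<^esub> s = \<zero>\<^bsub>M\<^esub>"
    using assms r_distr_scalar[of m "\<ominus>\<^bsub>S\<^esub> s" s] by (simp add: S.l_neg r_zero_scalar)
  then show ?thesis
    using assms by (simp add: M.minus_equality r_closed)
qed

text \<open>Faithfulness as defined only detects zero, so it is applied to the difference of
  \<open>r\<close> and \<open>r'\<close>. In this form it lets identities in \<open>R\<close> be
  checked on \<open>M\<close>.\<close>

lemma (in bimodule) faithful_left_eqI:
  assumes "faithful_left R M" "r \<in> carrier R" "r' \<in> carrier R"
    and eq: "\<And>m. m \<in> carrier M \<Longrightarrow> r \<odot>\<^bsub>M\<^esub> m = r' \<odot>\<^bsub>M\<^esub> m"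
  shows "r = r'"
proof -
  have "(r \<oplus>\<^bsub>R\<^esub> \<ominus>\<^bsub>R\<^esub> r') \<odot>\<^bsub>M\<^esub> m = \<zero>\<^bsub>M\<^esub>" if "m \<in> carrier M" for m
    using assms that by (simp add: l_distr_scalar l_minus_scalar eq M.r_neg l_closed)
  then have "r \<oplus>\<^bsub>R\<^esub> \<ominus>\<^bsub>R\<^esub> r' = \<zero>\<^bsub>R\<^esub>"
    using assms(1-3) unfolding faithful_left_def by simp
  then show ?thesis
    using assms(2,3) by (rule R.eq_if_minus_eq_zero)
qed

lemma (in bimodule) faithful_right_eqI:
  assumes "faithful_right S M" "s \<in> carrier S" "s' \<in> carrier S"
    and eq: "\<And>m. m \<in> carrier M \<Longrightarrow> m \<triangleleft>\<^bsub>M\<^esub> s = m \<triangleleft>\<^bsub>M\<^esub> s'"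
  shows "s = s'"
proof -
  have "m \<triangleleft>\<^bsub>M\<^esub> (s \<oplus>\<^bsub>S\<^esub> \<ominus>\<^bsub>S\<^esub> s') = \<zero>\<^bsub>M\<^esub>" if "m \<in> carrier M" for m
    using assms that by (simp add: r_distr_scalar r_minus_scalar eq M.r_neg r_closed)
  then have "s \<oplus>\<^bsub>S\<^esub> \<ominus>\<^bsub>S\<^esub> s' = \<zero>\<^bsub>S\<^esub>"
    using assms(1-3) unfolding faithful_right_def by simp
  then show ?thesis
    using assms(2,3) by (rule S.eq_if_minus_eq_zero)
qed

text \<open>Reduces the theorem to exhibiting a central \<open>z\<close> by which \<phi> multiplies.
  Centrality enters in moving \<open>z\<close> past \<open>x\<close>; once the two one-sided
  products agree, the remaining equation is associativity, \<open>z(xy) = (zx)y\<close>.\<close>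

lemma (in ring) central_mult_centralizer:
  assumes "additive_map R \<phi>" "z \<in> carrier R"
    and central: "\<And>x. x \<in> carrier R \<Longrightarrow> z \<otimes> x = x \<otimes> z"
    and \<phi>: "\<And>x. x \<in> carrier R \<Longrightarrow> \<phi> x = z \<otimes> x"
  shows "centralizer R \<phi>"
  unfolding centralizer_def
proof (intro conjI ballI)
  fix x y assume x: "x \<in> carrier R" and y: "y \<in> carrier R"
  show 1: "x \<otimes> \<phi> y = \<phi> x \<otimes> y"
    using x y assms(2) by (simp add: \<phi> central[OF x] m_assoc)
  show "\<phi> (x \<otimes> y) = x \<otimes> \<phi> y"
    unfolding 1 using x y assms(2) by (simp add: \<phi> m_assoc)
qed fact

text \<open>The matrix hypothesis read entry by entry, with \<open>X = (r, m, s)\<close> and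
  \<open>Y = (r', m', s')\<close>: the last six premises are the entries of \<open>XY = 0\<close>
  and \<open>YX = 0\<close>, the conclusions those of the Jordan product of \<open>X\<close> with
  the image \<open>(a, b, c)\<close> of \<open>Y\<close>. A test pair with many zeros then yields
  one usable equation per entry.\<close>

lemma (in bimodule) Tri_jordan_annihilating:
  assumes ann: "\<forall>X\<in>carrier (Tri R M S). \<forall>Y\<in>carrier (Tri R M S).
        X \<otimes>\<^bsub>Tri R M S\<^esub> Y = \<zero>\<^bsub>Tri R M S\<^esub> \<longrightarrow> Y \<otimes>\<^bsub>Tri R M S\<^esub> X = \<zero>\<^bsub>Tri R M S\<^esub> \<longrightarrow>
        X \<otimes>\<^bsub>Tri R M S\<^esub> \<phi> Y \<oplus>\<^bsub>Tri R M S\<^esub> \<phi> Y \<otimes>\<^bsub>Tri R M S\<^esub> X = \<zero>\<^bsub>Tri R M S\<^esub>"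
    and "\<phi> (r', m', s') = (a, b, c)"
    and "r \<in> carrier R" "m \<in> carrier M" "s \<in> carrier S"
    and "r' \<in> carrier R" "m' \<in> carrier M" "s' \<in> carrier S"
    and "r \<otimes>\<^bsub>R\<^esub> r' = \<zero>\<^bsub>R\<^esub>" "r \<odot>\<^bsub>M\<^esub> m' \<oplus>\<^bsub>M\<^esub> m \<triangleleft>\<^bsub>M\<^esub> s' = \<zero>\<^bsub>M\<^esub>" "s \<otimes>\<^bsub>S\<^esub> s' = \<zero>\<^bsub>S\<^esub>"
    and "r' \<otimes>\<^bsub>R\<^esub> r = \<zero>\<^bsub>R\<^esub>" "r' \<odot>\<^bsub>M\<^esub> m \<oplus>\<^bsub>M\<^esub> m' \<triangleleft>\<^bsub>M\<^esub> s = \<zero>\<^bsub>M\<^esub>" "s' \<otimes>\<^bsub>S\<^esub> s = \<zero>\<^bsub>S\<^esub>"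
  shows "r \<otimes>\<^bsub>R\<^esub> a \<oplus>\<^bsub>R\<^esub> a \<otimes>\<^bsub>R\<^esub> r = \<zero>\<^bsub>R\<^esub>"
    and "(r \<odot>\<^bsub>M\<^esub> b \<oplus>\<^bsub>M\<^esub> m \<triangleleft>\<^bsub>M\<^esub> c) \<oplus>\<^bsub>M\<^esub> (a \<odot>\<^bsub>M\<^esub> m \<oplus>\<^bsub>M\<^esub> b \<triangleleft>\<^bsub>M\<^esub> s) = \<zero>\<^bsub>M\<^esub>"
    and "s \<otimes>\<^bsub>S\<^esub> c \<oplus>\<^bsub>S\<^esub> c \<otimes>\<^bsub>S\<^esub> s = \<zero>\<^bsub>S\<^esub>"
  using ann[rule_format, of "(r, m, s)" "(r', m', s')"] assms(2-) by (simp_all add: Tri_def)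

theorem theorem3p1:
  fixes R :: "('a, 'c) ring_scheme"
    and S :: "('b, 'd) ring_scheme"
    and M :: "('a, 'm, 'b, 'e) bimodule_scheme"
    and \<phi> :: "'a \<times> 'm \<times> 'b \<Rightarrow> 'a \<times> 'm \<times> 'b"
  defines "T \<equiv> Tri R M S"
  assumes "ring R" and "two_torsion_free R"
    and "ring S" and "two_torsion_free S"
    and "bimodule R S M" and "two_torsion_free M"
    and "faithful_left R M" and "faithful_right S M"
    and "additive_map T \<phi>"
    and "\<And>X Y. \<lbrakk>X \<in> carrier T; Y \<in> carrier T;
          X \<otimes>\<^bsub>T\<^esub> Y = \<zero>\<^bsub>T\<^esub>; Y \<otimes>\<^bsub>T\<^esub> X = \<zero>\<^bsub>T\<^esub>\<rbrakk> \<Longrightarrow>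
          X \<otimes>\<^bsub>T\<^esub> \<phi> Y \<oplus>\<^bsub>T\<^esub> \<phi> Y \<otimes>\<^bsub>T\<^esub> X = \<zero>\<^bsub>T\<^esub>"
  shows "centralizer T \<phi>"
proof -
  interpret bimodule R S M by fact
  interpret T: ring T unfolding T_def by (rule ring_Tri)
  note add = \<open>additive_map T \<phi>\<close>
  have "\<forall>X\<in>carrier T. \<forall>Y\<in>carrier T. X \<otimes>\<^bsub>T\<^esub> Y = \<zero>\<^bsub>T\<^esub> \<longrightarrow> Y \<otimes>\<^bsub>T\<^esub> X = \<zero>\<^bsub>T\<^esub> \<longrightarrow>
      X \<otimes>\<^bsub>T\<^esub> \<phi> Y \<oplus>\<^bsub>T\<^esub> \<phi> Y \<otimes>\<^bsub>T\<^esub> X = \<zero>\<^bsub>T\<^esub>"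
    by (intro ballI impI) (rule assms(11))
  note ann = Tri_jordan_annihilating[OF this[unfolded T_def]]
  note zs = l_zero_scalar l_zero_vector r_zero_scalar r_zero_vector
    l_closed r_closed l_unit r_unit
  have \<phi>_closed: "\<phi> X \<in> carrier T" if "X \<in> carrier T" for X
    using add that by (auto simp: additive_map_def hom_def)
  have \<phi>_add: "\<phi> (X \<oplus>\<^bsub>T\<^esub> Y) = \<phi> X \<oplus>\<^bsub>T\<^esub> \<phi> Y" if "X \<in> carrier T" "Y \<in> carrier T" for X Y
    using add that by (auto simp: additive_map_def hom_def)
  have R0: "x = \<zero>\<^bsub>R\<^esub>" if "x \<oplus>\<^bsub>R\<^esub> x = \<zero>\<^bsub>R\<^esub>" "x \<in> carrier R" for x
    using \<open>two_torsion_free R\<close> that unfolding two_torsion_free_def by blast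
  have S0: "x = \<zero>\<^bsub>S\<^esub>" if "x \<oplus>\<^bsub>S\<^esub> x = \<zero>\<^bsub>S\<^esub>" "x \<in> carrier S" for x
    using \<open>two_torsion_free S\<close> that unfolding two_torsion_free_def by blast

  have "\<exists>a\<in>carrier R. \<phi> (r, \<zero>\<^bsub>M\<^esub>, \<zero>\<^bsub>S\<^esub>) = (a, \<zero>\<^bsub>M\<^esub>, \<zero>\<^bsub>S\<^esub>)" if r: "r \<in> carrier R" for r
  proof -
    obtain a b c where abc: "\<phi> (r, \<zero>\<^bsub>M\<^esub>, \<zero>\<^bsub>S\<^esub>) = (a, b, c)" by (cases "\<phi> (r, \<zero>\<^bsub>M\<^esub>, \<zero>\<^bsub>S\<^esub>)")
    have cl: "a \<in> carrier R" "b \<in> carrier M" "c \<in> carrier S"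
      using \<phi>_closed[of "(r, \<zero>\<^bsub>M\<^esub>, \<zero>\<^bsub>S\<^esub>)"] r abc by (auto simp: T_def Tri_def)
    \<comment> \<open>The test element \<open>(0, 0, 1)\<close> annihilates \<open>(r, 0, 0)\<close>
      on both sides, and its Jordan product with \<open>(a, b, c)\<close> is
      \<open>(0, b, 2c)\<close>.\<close>
    have "b = \<zero>\<^bsub>M\<^esub>" "c \<oplus>\<^bsub>S\<^esub> c = \<zero>\<^bsub>S\<^esub>"
      using ann(2,3)[OF abc, of "\<zero>\<^bsub>R\<^esub>" "\<zero>\<^bsub>M\<^esub>" "\<one>\<^bsub>S\<^esub>"] r cl by (simp_all add: zs)
    then show ?thesis
      using abc cl S0[of c] by auto
  qed
  then obtain f where f: "f r \<in> carrier R" "\<phi> (r, \<zero>\<^bsub>M\<^esub>, \<zero>\<^bsub>S\<^esub>) = (f r, \<zero>\<^bsub>M\<^esub>, \<zero>\<^bsub>S\<^esub>)"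
    if "r \<in> carrier R" for r
    by metis

  have "\<exists>c\<in>carrier S. \<phi> (\<zero>\<^bsub>R\<^esub>, \<zero>\<^bsub>M\<^esub>, s) = (\<zero>\<^bsub>R\<^esub>, \<zero>\<^bsub>M\<^esub>, c)" if s: "s \<in> carrier S" for s
  proof -
    obtain a b c where abc: "\<phi> (\<zero>\<^bsub>R\<^esub>, \<zero>\<^bsub>M\<^esub>, s) = (a, b, c)" by (cases "\<phi> (\<zero>\<^bsub>R\<^esub>, \<zero>\<^bsub>M\<^esub>, s)")
    have cl: "a \<in> carrier R" "b \<in> carrier M" "c \<in> carrier S"
      using \<phi>_closed[of "(\<zero>\<^bsub>R\<^esub>, \<zero>\<^bsub>M\<^esub>, s)"] s abc by (auto simp: T_def Tri_def)
    \<comment> \<open>The complementary idempotent \<open>(1, 0, 0)\<close> gives the Jordan product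
      \<open>(2a, b, 0)\<close>.\<close>
    have "b = \<zero>\<^bsub>M\<^esub>" "a \<oplus>\<^bsub>R\<^esub> a = \<zero>\<^bsub>R\<^esub>"
      using ann(2,1)[OF abc, of "\<one>\<^bsub>R\<^esub>" "\<zero>\<^bsub>M\<^esub>" "\<zero>\<^bsub>S\<^esub>"] s cl by (simp_all add: zs)
    then show ?thesis
      using abc cl R0[of a] by auto
  qed
  then obtain g where g: "g s \<in> carrier S" "\<phi> (\<zero>\<^bsub>R\<^esub>, \<zero>\<^bsub>M\<^esub>, s) = (\<zero>\<^bsub>R\<^esub>, \<zero>\<^bsub>M\<^esub>, g s)"
    if "s \<in> carrier S" for s
    by metis

  have "\<exists>b\<in>carrier M. \<phi> (\<zero>\<^bsub>R\<^esub>, n, \<zero>\<^bsub>S\<^esub>) = (\<zero>\<^bsub>R\<^esub>, b, \<zero>\<^bsub>S\<^esub>)" if n: "n \<in> carrier M" for n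
  proof -
    obtain a b c where abc: "\<phi> (\<zero>\<^bsub>R\<^esub>, n, \<zero>\<^bsub>S\<^esub>) = (a, b, c)" by (cases "\<phi> (\<zero>\<^bsub>R\<^esub>, n, \<zero>\<^bsub>S\<^esub>)")
    have cl: "a \<in> carrier R" "b \<in> carrier M" "c \<in> carrier S"
      using \<phi>_closed[of "(\<zero>\<^bsub>R\<^esub>, n, \<zero>\<^bsub>S\<^esub>)"] n abc by (auto simp: T_def Tri_def)
    \<comment> \<open>No element with first entry \<open>1\<close> annihilates
      \<open>(0, n, 0)\<close> from the left unless \<open>n = 0\<close>. Adding
      \<open>(0, 0, 1)\<close> repairs this: \<open>(1, -n, 0)\<close> and \<open>(0, n, 1)\<close>
      annihilate each other. The image of \<open>(0, 0, 1)\<close> has first entry zero, so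
      \<open>a\<close> is unchanged and the first entry of the Jordan product is
      \<open>2a\<close>.\<close>
    have "\<phi> (\<zero>\<^bsub>R\<^esub>, n, \<one>\<^bsub>S\<^esub>) = (a, b, c \<oplus>\<^bsub>S\<^esub> g \<one>\<^bsub>S\<^esub>)"
      using \<phi>_add[of "(\<zero>\<^bsub>R\<^esub>, n, \<zero>\<^bsub>S\<^esub>)" "(\<zero>\<^bsub>R\<^esub>, \<zero>\<^bsub>M\<^esub>, \<one>\<^bsub>S\<^esub>)"] n cl g[of "\<one>\<^bsub>S\<^esub>"] abc
      by (simp add: T_def Tri_def)
    then have "a \<oplus>\<^bsub>R\<^esub> a = \<zero>\<^bsub>R\<^esub>"
      using ann(1)[of "\<zero>\<^bsub>R\<^esub>" n "\<one>\<^bsub>S\<^esub>" a b "c \<oplus>\<^bsub>S\<^esub> g \<one>\<^bsub>S\<^esub>" "\<one>\<^bsub>R\<^esub>" "\<ominus>\<^bsub>M\<^esub> n" "\<zero>\<^bsub>S\<^esub>"] n cl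
      by (simp add: zs M.r_neg)
    then have a: "a = \<zero>\<^bsub>R\<^esub>" using R0 cl by blast
    \<comment> \<open>Any \<open>(0, m, 0)\<close> and \<open>(0, n, 0)\<close> have zero products.
      The middle entry of the Jordan product is \<open>mc + am\<close>, which is \<open>mc\<close>
      now that \<open>a\<close> vanishes.\<close>
    have "m \<triangleleft>\<^bsub>M\<^esub> c = \<zero>\<^bsub>M\<^esub>" if "m \<in> carrier M" for m
      using ann(2)[OF abc, of "\<zero>\<^bsub>R\<^esub>" m "\<zero>\<^bsub>S\<^esub>"] n cl that by (simp add: zs a)
    then have "c = \<zero>\<^bsub>S\<^esub>"
      using \<open>faithful_right S M\<close> cl unfolding faithful_right_def by blast
    then show ?thesis
      using a abc cl by blast
  qed
  then obtain h where h: "h n \<in> carrier M" "\<phi> (\<zero>\<^bsub>R\<^esub>, n, \<zero>\<^bsub>S\<^esub>) = (\<zero>\<^bsub>R\<^esub>, h n, \<zero>\<^bsub>S\<^esub>)"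
    if "n \<in> carrier M" for n
    by metis

  have \<phi>_eq: "\<phi> (r, m, s) = (f r, h m, g s)"
    if "r \<in> carrier R" "m \<in> carrier M" "s \<in> carrier S" for r m s
  proof -
    have "\<phi> (r, m, \<zero>\<^bsub>S\<^esub>) = (f r, h m, \<zero>\<^bsub>S\<^esub>)"
      using \<phi>_add[of "(r, \<zero>\<^bsub>M\<^esub>, \<zero>\<^bsub>S\<^esub>)" "(\<zero>\<^bsub>R\<^esub>, m, \<zero>\<^bsub>S\<^esub>)"] that f h by (simp add: T_def Tri_def)
    then show ?thesis
      using \<phi>_add[of "(r, m, \<zero>\<^bsub>S\<^esub>)" "(\<zero>\<^bsub>R\<^esub>, \<zero>\<^bsub>M\<^esub>, s)"] that f g h by (simp add: T_def Tri_def)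
  qed
  \<comment> \<open>The image of the zero matrix is described twice, as \<open>(f 0, 0, 0)\<close>
    and as \<open>(0, 0, g 0)\<close>; comparing entries gives both claims.\<close>
  have f0: "f \<zero>\<^bsub>R\<^esub> = \<zero>\<^bsub>R\<^esub>" and g0: "g \<zero>\<^bsub>S\<^esub> = \<zero>\<^bsub>S\<^esub>"
    using f(2)[of "\<zero>\<^bsub>R\<^esub>"] g(2)[of "\<zero>\<^bsub>S\<^esub>"] by auto

  have h_r: "h (m \<triangleleft>\<^bsub>M\<^esub> s) = m \<triangleleft>\<^bsub>M\<^esub> g s" if m: "m \<in> carrier M" and s: "s \<in> carrier S" for m s
  proof -
    \<comment> \<open>Middle entry for \<open>X = (1, -m, 0)\<close> and
      \<open>Y = (0, ms, s)\<close>: in \<open>XY\<close> the terms \<open>ms\<close> and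
      \<open>-ms\<close> cancel, and the image of \<open>Y\<close> is
      \<open>(0, h (ms), g s)\<close>.\<close>
    have "h (m \<triangleleft>\<^bsub>M\<^esub> s) \<oplus>\<^bsub>M\<^esub> \<ominus>\<^bsub>M\<^esub> (m \<triangleleft>\<^bsub>M\<^esub> g s) = \<zero>\<^bsub>M\<^esub>"
      using ann(2)[OF \<phi>_eq, of "\<zero>\<^bsub>R\<^esub>" "m \<triangleleft>\<^bsub>M\<^esub> s" s "\<one>\<^bsub>R\<^esub>" "\<ominus>\<^bsub>M\<^esub> m" "\<zero>\<^bsub>S\<^esub>"] m s f g h
      by (simp add: zs f0 r_minus_vector M.r_neg)
    then show ?thesis
      by (rule M.eq_if_minus_eq_zero) (use m s g h in \<open>simp_all add: zs\<close>)
  qed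
  have h_l: "h (r \<odot>\<^bsub>M\<^esub> m) = f r \<odot>\<^bsub>M\<^esub> m" if r: "r \<in> carrier R" and m: "m \<in> carrier M" for r m
  proof -
    \<comment> \<open>Mirror image: \<open>X = (0, -m, 1)\<close> and \<open>Y = (r, rm, 0)\<close>,
      where the cancellation takes place in \<open>YX\<close>.\<close>
    have "h (r \<odot>\<^bsub>M\<^esub> m) \<oplus>\<^bsub>M\<^esub> \<ominus>\<^bsub>M\<^esub> (f r \<odot>\<^bsub>M\<^esub> m) = \<zero>\<^bsub>M\<^esub>"
      using ann(2)[OF \<phi>_eq, of r "r \<odot>\<^bsub>M\<^esub> m" "\<zero>\<^bsub>S\<^esub>" "\<zero>\<^bsub>R\<^esub>" "\<ominus>\<^bsub>M\<^esub> m" "\<one>\<^bsub>S\<^esub>"] r m f g h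
      by (simp add: zs g0 l_minus_vector M.r_neg M.l_neg M.a_comm)
    then show ?thesis
      by (rule M.eq_if_minus_eq_zero) (use r m f h in \<open>simp_all add: zs\<close>)
  qed

  define a where "a = f \<one>\<^bsub>R\<^esub>"
  define c where "c = g \<one>\<^bsub>S\<^esub>"
  have ac: "a \<in> carrier R" "c \<in> carrier S"
    using f g by (simp_all add: a_def c_def)
  have ha: "h m = a \<odot>\<^bsub>M\<^esub> m" and hc: "h m = m \<triangleleft>\<^bsub>M\<^esub> c" if "m \<in> carrier M" for m
    using h_l[of "\<one>\<^bsub>R\<^esub>" m] h_r[of m "\<one>\<^bsub>S\<^esub>"] that by (simp_all add: a_def c_def zs)
  \<comment> \<open>Both sides act alike on \<open>M\<close>:
    \<open>(f r)m = h (rm) = a(rm) = (ar)m\<close>.\<close>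
  have fl: "f r = a \<otimes>\<^bsub>R\<^esub> r" if "r \<in> carrier R" for r
    by (rule faithful_left_eqI[OF \<open>faithful_left R M\<close>])
      (use that f ac in \<open>simp_all add: l_assoc zs flip: h_l ha\<close>)
  have fr: "f r = r \<otimes>\<^bsub>R\<^esub> a" if "r \<in> carrier R" for r
  proof (rule faithful_left_eqI[OF \<open>faithful_left R M\<close>])
    fix m assume m: "m \<in> carrier M"
    \<comment> \<open>To get \<open>a\<close> to the right of \<open>r\<close>, \<open>h\<close> is
      expressed through the action of \<open>c\<close>, which commutes with that of
      \<open>r\<close>, and only then turned back:
      \<open>h (rm) = (rm)c = r(mc) = r(am)\<close>.\<close>
    have "f r \<odot>\<^bsub>M\<^esub> m = r \<odot>\<^bsub>M\<^esub> (m \<triangleleft>\<^bsub>M\<^esub> c)"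
      using that m ac by (simp add: hc zs lr_assoc flip: h_l)
    also have "\<dots> = (r \<otimes>\<^bsub>R\<^esub> a) \<odot>\<^bsub>M\<^esub> m"
      using that m ac by (simp add: l_assoc flip: ha hc)
    finally show "f r \<odot>\<^bsub>M\<^esub> m = (r \<otimes>\<^bsub>R\<^esub> a) \<odot>\<^bsub>M\<^esub> m" .
  qed (use that f ac in simp_all)
  have gr: "g s = s \<otimes>\<^bsub>S\<^esub> c" if "s \<in> carrier S" for s
    by (rule faithful_right_eqI[OF \<open>faithful_right S M\<close>])
      (use that g ac in \<open>simp_all add: r_assoc zs flip: h_r hc\<close>)
  have gl: "g s = c \<otimes>\<^bsub>S\<^esub> s" if "s \<in> carrier S" for s
  proof (rule faithful_right_eqI[OF \<open>faithful_right S M\<close>])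
    fix m assume m: "m \<in> carrier M"
    \<comment> \<open>The same exchange with the sides swapped:
      \<open>h (ms) = a(ms) = (am)s = (mc)s\<close>.\<close>
    have "m \<triangleleft>\<^bsub>M\<^esub> g s = (a \<odot>\<^bsub>M\<^esub> m) \<triangleleft>\<^bsub>M\<^esub> s"
      using that m ac by (simp add: ha zs lr_assoc flip: h_r)
    also have "\<dots> = m \<triangleleft>\<^bsub>M\<^esub> (c \<otimes>\<^bsub>S\<^esub> s)"
      using that m ac by (simp add: r_assoc flip: ha hc)
    finally show "m \<triangleleft>\<^bsub>M\<^esub> g s = m \<triangleleft>\<^bsub>M\<^esub> (c \<otimes>\<^bsub>S\<^esub> s)" .
  qed (use that g ac in simp_all)

  show ?thesis
  proof (rule T.central_mult_centralizer[OF add, of "(a, \<zero>\<^bsub>M\<^esub>, c)"])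
    show "(a, \<zero>\<^bsub>M\<^esub>, c) \<in> carrier T"
      using ac by (simp add: T_def Tri_def)
  next
    fix X assume "X \<in> carrier T"
    then obtain r m s where X: "X = (r, m, s)"
      and cl: "r \<in> carrier R" "m \<in> carrier M" "s \<in> carrier S"
      by (auto simp: T_def Tri_def)
    \<comment> \<open>These are the entries of the commutation of \<open>(a, 0, c)\<close> with
      \<open>X\<close>. The outer two equate the two formulas for \<open>f r\<close> and for
      \<open>g s\<close>, the middle one the two formulas for \<open>h m\<close>.\<close>
    have comm: "a \<otimes>\<^bsub>R\<^esub> r = r \<otimes>\<^bsub>R\<^esub> a" "a \<odot>\<^bsub>M\<^esub> m = m \<triangleleft>\<^bsub>M\<^esub> c" "c \<otimes>\<^bsub>S\<^esub> s = s \<otimes>\<^bsub>S\<^esub> c"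
      using cl fl fr ha hc gl gr by metis+
    show "(a, \<zero>\<^bsub>M\<^esub>, c) \<otimes>\<^bsub>T\<^esub> X = X \<otimes>\<^bsub>T\<^esub> (a, \<zero>\<^bsub>M\<^esub>, c)"
      using cl ac by (simp add: T_def Tri_def X zs comm)
    show "\<phi> X = (a, \<zero>\<^bsub>M\<^esub>, c) \<otimes>\<^bsub>T\<^esub> X"
      using cl ac by (simp add: T_def Tri_def X zs \<phi>_eq fl ha gl)
  qed
qed

end
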